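(* Let $X$ be a QFS-space and let $\mathcal{D}$ be a quasi-approximate identity for $X$ consisting of quasi-finitely separating maps. Then $X$ is a d-quasicontinuous space. In particular, $\{\delta(x) : \delta\in\mathcal{D},\ x\in X\}$ is a quasibase of $X$.
   Context: All topological spaces are $T_0$. For a space $(X,\tau)$, order-theoretic notions refer to the specialization order: $x\le y$ iff $x\in \mathrm{cl}_\tau\{y\}$. For $A\subseteq X$, $\uparrow A=\{x:\exists a\in A,\ a\le x\}$. A directed subset $D$ of $X$ (nonempty, every two elements have an upper bound in $D$), viewed as a net indexed by itself, converges to $x$, written $D\to_\tau x$, if it is eventually in every open neighbourhood of $x$. A set $U\subseteq X$ is directed open if for every directed $D$ and every $x\in U$ with $D\to_\tau x$ one has $D\cap U\neq\emptyset$; $d(X)$ is the family of directed open sets. $X$ is a directed space if $d(X)=\tau$. $\mathcal{P}^w(X)$ is the set of nonempty finite subsets of $X$. A nonempty family $\mathcal{F}\subseteq\mathcal{P}^w(X)$ is directed if for all $F_1,F_2\in\mathcal{F}$ there is $F\in\mathcal{F}$ with $F\subseteq\uparrow F_1\cap\uparrow F_2$; a directed family $\mathcal{F}$ converges to $x$, written $\mathcal{F}\to_\tau x$, if every open neighbourhood $U$ of $x$ contains some $F\in\mathcal{F}$ as a subset. For a directed space $X$ and $G,H\subseteq X$, $G\ll_d H$ means: for every directed $D\subseteq X$, if $D\to_\tau h$ for some $h\in H$, then $D\cap\uparrow G\ne\emptyset$; $G\ll_d x$ means $G\ll_d\{x\}$. Let $fin_d(x)=\{F\in\mathcal{P}^w(X):F\ll_d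 x\}$. $X$ is d-quasicontinuous if it is a directed space and for every $x\in X$ the family $fin_d(x)$ is directed and converges to $x$. A family $\mathcal{B}\subseteq\mathcal{P}^w(X)$ is a quasibase of $X$ if for every $x\in X$, $\mathcal{B}\cap fin_d(x)$ is a directed family and converges to $x$. For a directed space $X$, a map $\delta:X\to\mathcal{P}^w(X)$ is quasi-finitely separating if: (i) $a\le b$ implies $\delta(b)\subseteq\uparrow\delta(a)$; (ii) there is a finite set $F_\delta\subseteq X$ such that for every $x\in X$ there is $y\in F_\delta$ with $x\in\uparrow y\subseteq\uparrow\delta(x)$; (iii) for every directed $D\subseteq X$ with $D\to_\tau x$ and every open $U$ with $\delta(x)\subseteq U$, there is $d\in D$ with $\delta(d)\subseteq U$. A set $\mathcal{D}$ of maps $X\to\mathcal{P}^w(X)$ is directed if it is nonempty and for all $\delta_1,\delta_2\in\mathcal{D}$ there is $\delta\in\mathcal{D}$ with $\delta(x)\subseteq\uparrow\delta_1(x)\cap\uparrow\delta_2(x)$ for all $x\in X$. A quasi-approximate identity for $X$ is a directed set $\mathcal{D}$ of maps $X\to\mathcal{P}^w(X)$ such that for every $x\in X$, $\{\delta(x):\delta\in\mathcal{D}\}\to_\tau x$. A QFS-space is a directed space that has a quasi-approximate identity consisting of quasi-finitely separating maps. *)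

theory Defs
  imports "HOL-Analysis.Abstract_Topological_Spaces"
begin

text \<open>
  Spaces are abstract topologies \<^term>\<open>X :: 'a topology\<close> with underlying set \<^term>\<open>topspace X\<close>.
  The closure operator only sees points of the carrier, so the specialization order below
  relates points of \<^term>\<open>topspace X\<close> only.
\<close>

definition spec_le :: "'a topology \<Rightarrow> 'a \<Rightarrow> 'a \<Rightarrow> bool" where
  "spec_le X x y \<longleftrightarrow> x \<in> X closure_of {y}"

definition up_set :: "'a topology \<Rightarrow> 'a set \<Rightarrow> 'a set" where
  "up_set X A = {x \<in> topspace X. \<exists>a\<in>A. spec_le X a x}"

definition directed_subset :: "'a topology \<Rightarrow> 'a set \<Rightarrow> bool" where
  "directed_subset X D \<longleftrightarrow>
     D \<subseteq> topspace X \<and> D \<noteq> {} \<and> (\<forall>a\<in>D. \<forall>b\<in>D. \<exists>c\<in>D. spec_le X a c \<and> spec_le X b c)"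

text \<open>Convergence of a directed subset, regarded as a net indexed by itself.\<close>

definition dir_converges :: "'a topology \<Rightarrow> 'a set \<Rightarrow> 'a \<Rightarrow> bool" where
  "dir_converges X D x \<longleftrightarrow>
     x \<in> topspace X \<and>
     (\<forall>U. openin X U \<and> x \<in> U \<longrightarrow> (\<exists>d\<in>D. \<forall>e\<in>D. spec_le X d e \<longrightarrow> e \<in> U))"

definition directed_open :: "'a topology \<Rightarrow> 'a set \<Rightarrow> bool" where
  "directed_open X U \<longleftrightarrow>
     U \<subseteq> topspace X \<and>
     (\<forall>D x. directed_subset X D \<and> x \<in> U \<and> dir_converges X D x \<longrightarrow> D \<inter> U \<noteq> {})"

text \<open>The standing assumption that all spaces are \<open>T\<^sub>0\<close> is made part of this notion.\<close>

definition directed_space :: "'a topology \<Rightarrow> bool" where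
  "directed_space X \<longleftrightarrow> t0_space X \<and> {U. directed_open X U} = {U. openin X U}"

definition Pw :: "'a topology \<Rightarrow> 'a set set" where
  "Pw X = {F. F \<subseteq> topspace X \<and> finite F \<and> F \<noteq> {}}"

definition directed_family :: "'a topology \<Rightarrow> 'a set set \<Rightarrow> bool" where
  "directed_family X \<F> \<longleftrightarrow>
     \<F> \<subseteq> Pw X \<and> \<F> \<noteq> {} \<and>
     (\<forall>F1\<in>\<F>. \<forall>F2\<in>\<F>. \<exists>F\<in>\<F>. F \<subseteq> up_set X F1 \<inter> up_set X F2)"

definition family_converges :: "'a topology \<Rightarrow> 'a set set \<Rightarrow> 'a \<Rightarrow> bool" where
  "family_converges X \<F> x \<longleftrightarrow>
     x \<in> topspace X \<and> (\<forall>U. openin X U \<and> x \<in> U \<longrightarrow> (\<exists>F\<in>\<F>. F \<subseteq> U))"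

definition d_way_below :: "'a topology \<Rightarrow> 'a set \<Rightarrow> 'a set \<Rightarrow> bool" where
  "d_way_below X G H \<longleftrightarrow>
     (\<forall>D. directed_subset X D \<and> (\<exists>h\<in>H. dir_converges X D h) \<longrightarrow> D \<inter> up_set X G \<noteq> {})"

definition fin_d :: "'a topology \<Rightarrow> 'a \<Rightarrow> 'a set set" where
  "fin_d X x = {F \<in> Pw X. d_way_below X F {x}}"

definition d_quasicontinuous :: "'a topology \<Rightarrow> bool" where
  "d_quasicontinuous X \<longleftrightarrow>
     directed_space X \<and>
     (\<forall>x\<in>topspace X. directed_family X (fin_d X x) \<and> family_converges X (fin_d X x) x)"

definition quasibase :: "'a topology \<Rightarrow> 'a set set \<Rightarrow> bool" where
  "quasibase X \<B> \<longleftrightarrow>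
     \<B> \<subseteq> Pw X \<and>
     (\<forall>x\<in>topspace X.
        directed_family X (\<B> \<inter> fin_d X x) \<and> family_converges X (\<B> \<inter> fin_d X x) x)"

text \<open>
  Maps from the space to its nonempty finite subsets are total functions of which only the
  values on \<^term>\<open>topspace X\<close> are constrained or used.
\<close>

definition quasi_finitely_separating :: "'a topology \<Rightarrow> ('a \<Rightarrow> 'a set) \<Rightarrow> bool" where
  "quasi_finitely_separating X \<delta> \<longleftrightarrow>
     \<delta> \<in> topspace X \<rightarrow> Pw X \<and>
     (\<forall>a\<in>topspace X. \<forall>b\<in>topspace X. spec_le X a b \<longrightarrow> \<delta> b \<subseteq> up_set X (\<delta> a)) \<and>
     (\<exists>F. finite F \<and> F \<subseteq> topspace X \<and>
        (\<forall>x\<in>topspace X. \<exists>y\<in>F. x \<in> up_set X {y} \<and> up_set X {y} \<subseteq> up_set X (\<delta> x))) \<and>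
     (\<forall>D. \<forall>x\<in>topspace X. \<forall>U.
        directed_subset X D \<and> dir_converges X D x \<and> openin X U \<and> \<delta> x \<subseteq> U
        \<longrightarrow> (\<exists>d\<in>D. \<delta> d \<subseteq> U))"

definition directed_maps :: "'a topology \<Rightarrow> ('a \<Rightarrow> 'a set) set \<Rightarrow> bool" where
  "directed_maps X \<D> \<longleftrightarrow>
     \<D> \<subseteq> (topspace X \<rightarrow> Pw X) \<and> \<D> \<noteq> {} \<and>
     (\<forall>\<delta>1\<in>\<D>. \<forall>\<delta>2\<in>\<D>. \<exists>\<delta>\<in>\<D>. \<forall>x\<in>topspace X.
        \<delta> x \<subseteq> up_set X (\<delta>1 x) \<inter> up_set X (\<delta>2 x))"

definition quasi_approximate_identity :: "'a topology \<Rightarrow> ('a \<Rightarrow> 'a set) set \<Rightarrow> bool" where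
  "quasi_approximate_identity X \<D> \<longleftrightarrow>
     directed_maps X \<D> \<and> (\<forall>x\<in>topspace X. family_converges X {\<delta> x | \<delta>. \<delta> \<in> \<D>} x)"

definition QFS_space :: "'a topology \<Rightarrow> bool" where
  "QFS_space X \<longleftrightarrow>
     directed_space X \<and>
     (\<exists>\<D>. quasi_approximate_identity X \<D> \<and> (\<forall>\<delta>\<in>\<D>. quasi_finitely_separating X \<delta>))"

end

theory Submission
  imports Defs
begin

text \<open>
  Two facts carry the proof. The first is that \<open>\<delta> x \<lless>\<^sub>d x\<close> for every quasi-finitely separating
  \<open>\<delta>\<close>: consider the points of the finite separating set outside \<open>\<up>\<delta> x\<close>; the complement of
  their closure is an open neighbourhood of \<open>\<delta> x\<close>, so by the continuity of \<open>\<delta>\<close> it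
  contains \<open>\<delta> d\<close> for some member \<open>d\<close> of any directed set that converges to \<open>x\<close>. A separating point
  for \<open>d\<close> lies in \<open>\<up>\<delta> d\<close>, hence in that neighbourhood, so it must belong to \<open>\<up>\<delta> x\<close>, and, being
  below \<open>d\<close>, it puts \<open>d\<close> there as well (lemma \<open>quasi_finitely_separating_imp_way_below\<close>).

  By this fact the directed family of the sets \<open>\<delta> x\<close>, for \<open>\<delta> \<in> \<D>\<close>, which converges to \<open>x\<close>, lies
  inside \<open>fin\<^sub>d(x)\<close>. The second fact is that any such family is cofinal in \<open>fin\<^sub>d(x)\<close>: if no
  member lay in \<open>\<up>G\<close>, Rudin's lemma would select from the remainders outside \<open>\<up>G\<close> a directed set
  that still converges to \<open>x\<close>, which contradicts \<open>G \<lless>\<^sub>d x\<close>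
  (lemma \<open>d_way_below_directed_family\<close>). Hence every family between
  \<open>{\<delta> x | \<delta> \<in> \<D>}\<close> and \<open>fin\<^sub>d(x)\<close> is directed and converges to \<open>x\<close>. Both
  \<open>fin\<^sub>d(x)\<close> and its intersection with the candidate quasibase are of this kind.
\<close>

section \<open>The specialization order\<close>

lemma spec_le_refl: "x \<in> topspace X \<Longrightarrow> spec_le X x x"
  by (auto simp: spec_le_def in_closure_of)

lemma spec_le_openin: "spec_le X x y \<Longrightarrow> openin X U \<Longrightarrow> x \<in> U \<Longrightarrow> y \<in> U"
  by (auto simp: spec_le_def in_closure_of)

lemma spec_le_trans: "spec_le X x y \<Longrightarrow> spec_le X y z \<Longrightarrow> spec_le X x z"
  by (auto simp: spec_le_def in_closure_of)

lemma up_set_upward: "a \<in> up_set X G \<Longrightarrow> spec_le X a b \<Longrightarrow> b \<in> topspace X \<Longrightarrow> b \<in> up_set X G"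
  by (auto simp: up_set_def intro: spec_le_trans)

lemma up_set_subset_up_set: "G \<subseteq> up_set X H \<Longrightarrow> up_set X G \<subseteq> up_set X H"
  unfolding up_set_def by (blast intro: spec_le_trans)

lemma up_set_openin_subset: "openin X U \<Longrightarrow> G \<subseteq> U \<Longrightarrow> up_set X G \<subseteq> U"
  by (auto simp: up_set_def intro: spec_le_openin)

section \<open>Rudin's lemma\<close>

text \<open>
  By Zorn's lemma there is a maximal upper set containing no member of the family;
  a chain of such sets has such a union because the members of the family are finite. The
  complement of a maximal one meets every member, and maximality makes it directed: adjoining
  the elements above any point \<open>a\<close> of the complement must absorb some member of the family.
\<close>

lemma Rudin:
  assumes refl: "reflp_on W le" and trans: "transp_on W le"
    and ne: "\<F> \<noteq> {}" and fin: "\<forall>M\<in>\<F>. M \<subseteq> W \<and> finite M \<and> M \<noteq> {}"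
    and dir: "\<forall>M1\<in>\<F>. \<forall>M2\<in>\<F>. \<exists>M\<in>\<F>. \<forall>c\<in>M. (\<exists>a\<in>M1. le a c) \<and> (\<exists>b\<in>M2. le b c)"
  shows "\<exists>D\<subseteq>W. D \<noteq> {} \<and> (\<forall>a\<in>D. \<forall>b\<in>D. \<exists>c\<in>D. le a c \<and> le b c) \<and> (\<forall>M\<in>\<F>. M \<inter> D \<noteq> {})"
proof -
  define A where "A = {V. V \<subseteq> W \<and> (\<forall>x\<in>V. \<forall>y\<in>W. le x y \<longrightarrow> y \<in> V) \<and> (\<forall>M\<in>\<F>. \<not> M \<subseteq> V)}"
  have "{} \<in> A"
    using fin by (auto simp: A_def)
  moreover have "\<Union>C \<in> A" if C: "C \<noteq> {}" "subset.chain A C" for C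
  proof -
    have sub: "V \<in> A" if "V \<in> C" for V
      using C(2) that by (auto simp: subset_chain_def)
    have "\<not> M \<subseteq> \<Union>C" if "M \<in> \<F>" for M
    proof
      assume "M \<subseteq> \<Union>C"
      then obtain V where "V \<in> C" "M \<subseteq> V"
        using finite_subset_Union_chain[of M C A] fin \<open>M \<in> \<F>\<close> C by blast
      with sub[of V] that show False
        by (auto simp: A_def)
    qed
    moreover have "\<Union>C \<subseteq> W" "\<forall>x\<in>\<Union>C. \<forall>y\<in>W. le x y \<longrightarrow> y \<in> \<Union>C"
      using sub unfolding A_def by blast+
    ultimately show ?thesis
      by (simp add: A_def)
  qed
  ultimately obtain V where V: "V \<in> A" and max: "\<And>V'. V' \<in> A \<Longrightarrow> V \<subseteq> V' \<Longrightarrow> V' = V"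
    using subset_Zorn_nonempty[of A] by blast
  have up: "y \<in> V" if "x \<in> V" "y \<in> W" "le x y" for x y
    using V that by (auto simp: A_def)
  have absorb: "\<exists>M\<in>\<F>. \<forall>m\<in>M. m \<in> V \<or> le a m" if a: "a \<in> W - V" for a
  proof (rule ccontr)
    assume none: "\<not> ?thesis"
    let ?V' = "V \<union> {y \<in> W. le a y}"
    have "\<forall>x\<in>?V'. \<forall>y\<in>W. le x y \<longrightarrow> y \<in> ?V'"
      using up a transp_onD[OF trans] by blast
    then have "?V' \<in> A"
      using V none by (auto simp: A_def)
    then have "?V' = V"
      by (rule max) blast
    then show False
      using a reflp_onD[OF refl] by blast
  qed
  have meet: "M \<inter> (W - V) \<noteq> {}" if "M \<in> \<F>" for M
  proof -
    have "M \<subseteq> W" "\<not> M \<subseteq> V"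
      using V fin that by (simp_all add: A_def)
    then show ?thesis
      by blast
  qed
  have "\<exists>c\<in>W - V. le a c \<and> le b c" if a: "a \<in> W - V" and b: "b \<in> W - V" for a b
  proof -
    obtain M1 where M1: "M1 \<in> \<F>" "\<forall>m\<in>M1. m \<in> V \<or> le a m"
      using absorb[OF a] by blast
    obtain M2 where M2: "M2 \<in> \<F>" "\<forall>m\<in>M2. m \<in> V \<or> le b m"
      using absorb[OF b] by blast
    obtain M where M: "M \<in> \<F>" "\<forall>c\<in>M. (\<exists>a\<in>M1. le a c) \<and> (\<exists>b\<in>M2. le b c)"
      using dir M1(1) M2(1) by blast
    obtain c where c: "c \<in> M" "c \<in> W - V"
      using meet[OF M(1)] by blast
    obtain m1 m2 where m: "m1 \<in> M1" "le m1 c" "m2 \<in> M2" "le m2 c"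
      using M(2) c(1) by blast
    have "M1 \<subseteq> W" "M2 \<subseteq> W"
      using fin M1(1) M2(1) by simp_all
    then have W: "m1 \<in> W" "m2 \<in> W"
      using m by auto
    \<comment> \<open>Below a point of the complement everything is in the complement.\<close>
    have "le a m1" "le b m2"
      using m M1(2) M2(2) up c(2) by blast+
    then have "le a c" "le b c"
      using transp_onD[OF trans] a b c(2) m W by blast+
    then show ?thesis
      using c(2) by blast
  qed
  moreover have "W - V \<noteq> {}"
    using meet ne by blast
  ultimately show ?thesis
    using meet by (intro exI[of _ "W - V"]) auto
qed

section \<open>Cofinality of convergent families in \<open>fin\<^sub>d(x)\<close>\<close>

text \<open>
  What Rudin's lemma yields here: although \<open>\<lless>\<^sub>d\<close> is tested on directed sets of points only, it can
  also be tested on directed families of finite sets. The points outside \<open>\<up>G\<close> form a lower set,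
  so removing \<open>\<up>G\<close> from every member preserves directedness. A directed set of points meeting
  every member of a convergent family converges to the same limit, since open sets are upper sets.
\<close>

lemma d_way_below_directed_family:
  assumes wb: "d_way_below X G {x}"
    and dir: "directed_family X \<A>" and conv: "family_converges X \<A> x"
  shows "\<exists>A\<in>\<A>. A \<subseteq> up_set X G"
proof (rule ccontr)
  assume none: "\<not> ?thesis"
  let ?W = "topspace X - up_set X G" and ?\<M> = "(\<lambda>A. A - up_set X G) ` \<A>"
  have refl: "reflp_on ?W (spec_le X)" and trans: "transp_on ?W (spec_le X)"
    by (auto intro!: reflp_onI transp_onI intro: spec_le_refl spec_le_trans)
  have ne: "?\<M> \<noteq> {}"
    and fin: "\<forall>M\<in>?\<M>. M \<subseteq> ?W \<and> finite M \<and> M \<noteq> {}"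
    using dir none by (auto simp: directed_family_def Pw_def)
  have "\<exists>M\<in>?\<M>. \<forall>c\<in>M. (\<exists>a\<in>M1. spec_le X a c) \<and> (\<exists>b\<in>M2. spec_le X b c)"
    if "M1 \<in> ?\<M>" "M2 \<in> ?\<M>" for M1 M2
  proof -
    obtain A1 A2 where A12: "A1 \<in> \<A>" "M1 = A1 - up_set X G" "A2 \<in> \<A>" "M2 = A2 - up_set X G"
      using \<open>M1 \<in> ?\<M>\<close> \<open>M2 \<in> ?\<M>\<close> by blast
    then obtain A where A: "A \<in> \<A>" "A \<subseteq> up_set X A1 \<inter> up_set X A2"
      using dir unfolding directed_family_def by blast
    have "(\<exists>a\<in>M1. spec_le X a c) \<and> (\<exists>b\<in>M2. spec_le X b c)" if "c \<in> A - up_set X G" for c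
    proof -
      have "c \<in> ?W" "\<exists>a\<in>A1. spec_le X a c" "\<exists>b\<in>A2. spec_le X b c"
        using that A(2) by (auto simp: up_set_def)
      then show ?thesis
        using that A12 up_set_upward[of _ X G c] by blast
    qed
    then show ?thesis
      using A(1) by blast
  qed
  then have "\<forall>M1\<in>?\<M>. \<forall>M2\<in>?\<M>. \<exists>M\<in>?\<M>.
      \<forall>c\<in>M. (\<exists>a\<in>M1. spec_le X a c) \<and> (\<exists>b\<in>M2. spec_le X b c)"
    by (intro ballI)
  from Rudin[OF refl trans ne fin this]
  obtain D where D: "D \<subseteq> ?W" "D \<noteq> {}" "\<forall>a\<in>D. \<forall>b\<in>D. \<exists>c\<in>D. spec_le X a c \<and> spec_le X b c"
    and meet: "\<forall>M\<in>?\<M>. M \<inter> D \<noteq> {}"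
    by (elim exE conjE)
  have "dir_converges X D x"
    unfolding dir_converges_def
  proof (intro conjI allI impI)
    show "x \<in> topspace X"
      using conv by (simp add: family_converges_def)
    fix U assume U: "openin X U \<and> x \<in> U"
    then obtain A where "A \<in> \<A>" "A \<subseteq> U"
      using conv by (auto simp: family_converges_def)
    moreover from this have "(A - up_set X G) \<inter> D \<noteq> {}"
      using meet by simp
    ultimately obtain d where "d \<in> D" "d \<in> U"
      by blast
    then show "\<exists>d\<in>D. \<forall>e\<in>D. spec_le X d e \<longrightarrow> e \<in> U"
      using U by (blast intro: spec_le_openin)
  qed
  moreover have "directed_subset X D"
    using D by (auto simp: directed_subset_def)
  ultimately show False
    using wb D(1) by (auto simp: d_way_below_def)
qed

text \<open>
  Enlarging \<open>\<A>\<close> within \<open>fin\<^sub>d(x)\<close> keeps it directed because \<open>\<A>\<close> stays cofinal: any two sets in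
  \<open>fin\<^sub>d(x)\<close> are refined by members of \<open>\<A>\<close>, and these have a common refinement in \<open>\<A>\<close>.
\<close>

lemma directed_convergent_in_fin_d_superset:
  assumes dir: "directed_family X \<A>" and conv: "family_converges X \<A> x"
    and sub: "\<A> \<subseteq> \<C>" "\<C> \<subseteq> fin_d X x"
  shows "directed_family X \<C> \<and> family_converges X \<C> x"
proof -
  have "\<exists>C\<in>\<C>. C \<subseteq> up_set X C1 \<inter> up_set X C2" if "C1 \<in> \<C>" "C2 \<in> \<C>" for C1 C2
  proof -
    have "\<exists>A\<in>\<A>. A \<subseteq> up_set X C" if "C \<in> \<C>" for C
      using d_way_below_directed_family[OF _ dir conv] that sub(2) by (auto simp: fin_d_def)
    then obtain A1 A2 where A12: "A1 \<in> \<A>" "A1 \<subseteq> up_set X C1" "A2 \<in> \<A>" "A2 \<subseteq> up_set X C2"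
      using \<open>C1 \<in> \<C>\<close> \<open>C2 \<in> \<C>\<close> by blast
    then obtain A where A: "A \<in> \<A>" "A \<subseteq> up_set X A1 \<inter> up_set X A2"
      using dir unfolding directed_family_def by blast
    have "up_set X A1 \<subseteq> up_set X C1" "up_set X A2 \<subseteq> up_set X C2"
      using A12 by (simp_all add: up_set_subset_up_set)
    with A sub(1) show ?thesis
      by (intro bexI[of _ A]) auto
  qed
  moreover have "\<C> \<subseteq> Pw X" "\<C> \<noteq> {}"
    using sub dir by (auto simp: fin_d_def directed_family_def)
  moreover have "family_converges X \<C> x"
    using conv sub(1) unfolding family_converges_def by (meson subsetD)
  ultimately show ?thesis
    by (simp add: directed_family_def)
qed

section \<open>Quasi-finitely separating maps\<close>

text \<open>
  With \<open>F\<close> the finite separating set, the continuity condition is applied to the complement of the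
  closure of \<open>F - \<up>\<delta> x\<close>. Finiteness of \<open>F\<close> makes this closure a union of closures of points, that is,
  the set of all points below some point of \<open>F - \<up>\<delta> x\<close>, which cannot contain an element of \<open>\<delta> x\<close>.
\<close>

lemma quasi_finitely_separating_imp_way_below:
  assumes sep: "quasi_finitely_separating X \<delta>" and x: "x \<in> topspace X"
  shows "d_way_below X (\<delta> x) {x}"
  unfolding d_way_below_def
proof (intro allI impI)
  fix D assume "directed_subset X D \<and> (\<exists>h\<in>{x}. dir_converges X D h)"
  then have D: "directed_subset X D" and lim: "dir_converges X D x"
    by simp_all
  have "\<exists>F. finite F \<and> F \<subseteq> topspace X \<and>
      (\<forall>z\<in>topspace X. \<exists>y\<in>F. z \<in> up_set X {y} \<and> up_set X {y} \<subseteq> up_set X (\<delta> z))"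
    using sep unfolding quasi_finitely_separating_def by (elim conjE)
  then obtain F where F: "finite F" "F \<subseteq> topspace X"
    and F_sep: "\<forall>z\<in>topspace X. \<exists>y\<in>F. z \<in> up_set X {y} \<and> up_set X {y} \<subseteq> up_set X (\<delta> z)"
    by (elim exE conjE)
  have cont: "\<forall>D. \<forall>x\<in>topspace X. \<forall>U. directed_subset X D \<and> dir_converges X D x \<and> openin X U \<and>
      \<delta> x \<subseteq> U \<longrightarrow> (\<exists>d\<in>D. \<delta> d \<subseteq> U)"
    using sep unfolding quasi_finitely_separating_def by (elim conjE)
  define K where "K = F - up_set X (\<delta> x)"
  define U where "U = topspace X - X closure_of K"
  have K: "finite K" "K \<subseteq> topspace X"
    using F by (auto simp: K_def)
  have clK: "X closure_of K = (\<Union>y\<in>K. X closure_of {y})"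
    using closure_of_Union[of "(\<lambda>y. {y}) ` K" X] K(1) by simp
  have "\<delta> x \<subseteq> topspace X"
    using sep x by (auto simp: quasi_finitely_separating_def Pw_def)
  moreover have "\<delta> x \<inter> X closure_of K = {}"
  proof (intro equals0I, elim IntE)
    fix a assume a: "a \<in> \<delta> x" "a \<in> X closure_of K"
    then obtain y where y: "y \<in> K" "spec_le X a y"
      by (auto simp: clK spec_le_def)
    then have "y \<in> up_set X (\<delta> x)"
      using a(1) K(2) by (auto simp: up_set_def)
    then show False
      using y(1) by (simp add: K_def)
  qed
  ultimately have "\<delta> x \<subseteq> U"
    by (auto simp: U_def)
  moreover have U: "openin X U"
    by (auto simp: U_def)
  ultimately obtain d where d: "d \<in> D" "\<delta> d \<subseteq> U"
    using cont[rule_format, OF x, of D U] D lim by blast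
  then have dX: "d \<in> topspace X"
    using D by (auto simp: directed_subset_def)
  then obtain y where y: "y \<in> F" "d \<in> up_set X {y}" "up_set X {y} \<subseteq> up_set X (\<delta> d)"
    using bspec[OF F_sep dX] by (elim bexE conjE)
  have "y \<in> up_set X {y}"
    using y(1) F(2) by (auto simp: up_set_def intro: spec_le_refl)
  then have "y \<in> U"
    using y(3) up_set_openin_subset[OF U d(2)] by blast
  moreover have "K \<subseteq> X closure_of K"
    using K(2) by (rule closure_of_subset)
  ultimately have "y \<in> up_set X (\<delta> x)"
    using y(1) by (auto simp: U_def K_def)
  moreover have "spec_le X y d"
    using y(2) by (simp add: up_set_def)
  ultimately have "d \<in> up_set X (\<delta> x)"
    using dX by (rule up_set_upward)
  then show "D \<inter> up_set X (\<delta> x) \<noteq> {}"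
    using d(1) by blast
qed

theorem proposition3p5:
  fixes X :: "'a topology" and \<D> :: "('a \<Rightarrow> 'a set) set"
  assumes "QFS_space X"
    and "quasi_approximate_identity X \<D>"
    and "\<forall>\<delta>\<in>\<D>. quasi_finitely_separating X \<delta>"
  shows "d_quasicontinuous X \<and> quasibase X {\<delta> x | \<delta> x. \<delta> \<in> \<D> \<and> x \<in> topspace X}"
proof -
  let ?\<B> = "{\<delta> x | \<delta> x. \<delta> \<in> \<D> \<and> x \<in> topspace X}"
  have maps: "directed_maps X \<D>"
    and conv: "\<And>x. x \<in> topspace X \<Longrightarrow> family_converges X {\<delta> x | \<delta>. \<delta> \<in> \<D>} x"
    using assms(2) by (auto simp: quasi_approximate_identity_def)
  have Pw: "\<delta> x \<in> Pw X" if "\<delta> \<in> \<D>" "x \<in> topspace X" for \<delta> x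
    using maps that by (auto simp: directed_maps_def)
  have refine: "\<forall>\<delta>1\<in>\<D>. \<forall>\<delta>2\<in>\<D>. \<exists>\<delta>\<in>\<D>. \<forall>x\<in>topspace X.
      \<delta> x \<subseteq> up_set X (\<delta>1 x) \<inter> up_set X (\<delta>2 x)"
    using maps unfolding directed_maps_def by (elim conjE)
  have dir: "directed_family X {\<delta> x | \<delta>. \<delta> \<in> \<D>}" if "x \<in> topspace X" for x
  proof -
    have "\<exists>A\<in>{\<delta> x | \<delta>. \<delta> \<in> \<D>}. A \<subseteq> up_set X (\<delta>1 x) \<inter> up_set X (\<delta>2 x)"
      if "\<delta>1 \<in> \<D>" "\<delta>2 \<in> \<D>" for \<delta>1 \<delta>2
    proof -
      from bspec[OF bspec[OF refine \<open>\<delta>1 \<in> \<D>\<close>] \<open>\<delta>2 \<in> \<D>\<close>]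
      obtain \<delta> where "\<delta> \<in> \<D>" "\<forall>x\<in>topspace X. \<delta> x \<subseteq> up_set X (\<delta>1 x) \<inter> up_set X (\<delta>2 x)"
        by (elim bexE)
      then show ?thesis
        using \<open>x \<in> topspace X\<close> by (intro bexI[of _ "\<delta> x"]) auto
    qed
    moreover have "\<D> \<noteq> {}"
      using maps by (simp add: directed_maps_def)
    ultimately show ?thesis
      using Pw that by (auto simp: directed_family_def)
  qed
  have fin: "{\<delta> x | \<delta>. \<delta> \<in> \<D>} \<subseteq> fin_d X x" if "x \<in> topspace X" for x
  proof
    fix A assume "A \<in> {\<delta> x | \<delta>. \<delta> \<in> \<D>}"
    then obtain \<delta> where \<delta>: "\<delta> \<in> \<D>" and A: "A = \<delta> x"
      by auto
    have "d_way_below X (\<delta> x) {x}"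
      by (rule quasi_finitely_separating_imp_way_below[OF bspec[OF assms(3) \<delta>] that])
    then show "A \<in> fin_d X x"
      using Pw[OF \<delta> that] by (simp add: A fin_d_def)
  qed
  have between: "directed_family X \<C> \<and> family_converges X \<C> x"
    if "x \<in> topspace X" "{\<delta> x | \<delta>. \<delta> \<in> \<D>} \<subseteq> \<C>" "\<C> \<subseteq> fin_d X x" for \<C> x
    by (rule directed_convergent_in_fin_d_superset[OF dir[OF that(1)] conv[OF that(1)] that(2,3)])
  have "d_quasicontinuous X"
    using assms(1) between[OF _ fin subset_refl] by (simp add: d_quasicontinuous_def QFS_space_def)
  moreover have "directed_family X (?\<B> \<inter> fin_d X x) \<and> family_converges X (?\<B> \<inter> fin_d X x) x"
    if "x \<in> topspace X" for x
    using fin[OF that] that by (intro between[OF that]) auto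
  then have "quasibase X ?\<B>"
    using Pw by (auto simp: quasibase_def)
  ultimately show ?thesis ..
qed

end
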